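(* Let $\delta=\log\big((2/3)\,2^{2/3}\big)=0.05663\ldots$ (natural logarithm). If $H\cong(\mathbb{Z}/q\mathbb{Z})^n$ for some prime power $q$ and some $n\geq 0$, then every tricolored sum-free set in $H$ has cardinality at most $3\cdot\lvert H\rvert^{1-\frac{\delta}{\log q}}$.
   Context: A tricolored sum-free set in an abelian group $H$ (written additively) is a set $M\subseteq S\times T\times U$, where $S,T,U\subseteq H$, such that $M$ is a 3-dimensional perfect matching on $S\times T\times U$ (each of the three coordinate projections $M\to S$, $M\to T$, $M\to U$ is a bijection), $s+t+u=0$ for all $(s,t,u)\in M$, and $s+t+u\neq 0$ for all $(s,t,u)\in (S\times T\times U)\setminus M$. Its cardinality is $\lvert M\rvert$. *)

theory Defs
  imports
    Complex_Main
    "HOL-Algebra.Product_Groups"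
    "HOL-Algebra.Elementary_Groups"
    "HOL-Number_Theory.Prime_Powers"
begin

definition perfect_matching3 :: "'a set \<Rightarrow> 'b set \<Rightarrow> 'c set \<Rightarrow> ('a \<times> 'b \<times> 'c) set \<Rightarrow> bool" where
  "perfect_matching3 S T U M \<longleftrightarrow>
     M \<subseteq> S \<times> T \<times> U \<and>
     bij_betw (\<lambda>(s, t, u). s) M S \<and>
     bij_betw (\<lambda>(s, t, u). t) M T \<and>
     bij_betw (\<lambda>(s, t, u). u) M U"

text \<open>The groups of HOL-Algebra are written multiplicatively, so the equation \<open>s + t + u = 0\<close>
  appears as \<open>s \<otimes> t \<otimes> u = \<one>\<close>.\<close>

definition tricolored_sum_free :: "('a, 'm) monoid_scheme \<Rightarrow> ('a \<times> 'a \<times> 'a) set \<Rightarrow> bool" where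
  "tricolored_sum_free H M \<longleftrightarrow>
     (\<exists>S T U. S \<subseteq> carrier H \<and> T \<subseteq> carrier H \<and> U \<subseteq> carrier H \<and>
        perfect_matching3 S T U M \<and>
        (\<forall>(s, t, u) \<in> M. s \<otimes>\<^bsub>H\<^esub> t \<otimes>\<^bsub>H\<^esub> u = \<one>\<^bsub>H\<^esub>) \<and>
        (\<forall>(s, t, u) \<in> (S \<times> T \<times> U) - M. s \<otimes>\<^bsub>H\<^esub> t \<otimes>\<^bsub>H\<^esub> u \<noteq> \<one>\<^bsub>H\<^esub>))"

definition tsf_delta :: real where
  "tsf_delta = ln ((2 / 3) * 2 powr (2 / 3))"

end

theory Submission
  imports Defs "HOL-Analysis.Convex"
begin

text \<open>The slice rank method. Write \<open>q = p ^ e\<close>. Modulo \<open>p\<close>, the binomial coefficient of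
  \<open>x + y + z + (q - 1)\<close> over \<open>q - 1\<close> is nonzero exactly if \<open>q\<close> divides \<open>x + y + z\<close>; the product of these over
  the \<open>n\<close> coordinates is therefore a diagonal tensor on \<open>M \<times> M \<times> M\<close>, of slice rank \<open>card M\<close>. Vandermonde's
  identity expands it into products of \<open>x\<^sub>i choose a\<^sub>i\<close>, \<open>y\<^sub>i choose b\<^sub>i\<close>, \<open>z\<^sub>i choose c\<^sub>i\<close> with
  \<open>a\<^sub>i + b\<^sub>i + c\<^sub>i \<le> q - 1\<close>, so that one of the three exponent vectors has sum at most \<open>n (q - 1) / 3\<close>;
  hence its slice rank is at most three times the number of such vectors. The linear algebra
  over the prime field is replaced by the pigeonhole principle for integer vectors modulo \<open>p\<close>.\<close>

section \<open>Homogeneous linear systems modulo \<open>p\<close>\<close>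

text \<open>Vectors on \<open>X\<close> with entries in \<open>{0..<p}\<close> outnumber the
  possible tuples of residues indexed by \<open>A\<close>, so two distinct vectors give the same
  tuple. Their difference solves the system, and it is nonzero modulo \<open>p\<close> because
  distinct entries below \<open>p\<close> are incongruent.\<close>

lemma homogeneous_system_mod_nontrivial:
  fixes f :: "'b \<Rightarrow> 'x \<Rightarrow> int" and p :: int
  assumes p: "p > 1" and X: "finite X" and A: "finite A" and less: "card A < card X"
  obtains k where "\<forall>\<alpha>\<in>A. p dvd (\<Sum>x\<in>X. k x * f \<alpha> x)" and "\<exists>x\<in>X. \<not> p dvd k x"
proof -
  define \<Phi> where "\<Phi> v = (\<lambda>\<alpha>\<in>A. (\<Sum>x\<in>X. v x * f \<alpha> x) mod p)" for v
  let ?V = "X \<rightarrow>\<^sub>E {0..<p}" and ?W = "A \<rightarrow>\<^sub>E {0..<p}"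
  have "card ?W < card ?V"
    using p less X A by (simp add: card_PiE)
  moreover have "\<Phi> ` ?V \<subseteq> ?W"
    using p by (auto simp: \<Phi>_def)
  moreover have "finite ?W"
    using A by (simp add: finite_PiE)
  ultimately have "card (\<Phi> ` ?V) < card ?V"
    by (meson card_mono le_less_trans)
  then have "\<not> inj_on \<Phi> ?V"
    by (rule pigeonhole)
  then obtain v w where vw: "v \<in> ?V" "w \<in> ?V" "\<Phi> v = \<Phi> w" "v \<noteq> w"
    by (auto simp: inj_on_def)
  then obtain x where x: "x \<in> X" "v x \<noteq> w x"
    by (meson PiE_ext)
  have "0 \<le> v x" "v x < p" "0 \<le> w x" "w x < p"
    using vw x by (auto dest!: PiE_mem[where x = x])
  then have "\<not> p dvd v x - w x"
    using x(2) by (metis mod_eq_dvd_iff mod_pos_pos_trivial)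
  moreover have "p dvd (\<Sum>x\<in>X. (v x - w x) * f \<alpha> x)" if "\<alpha> \<in> A" for \<alpha>
  proof -
    have "(\<Sum>x\<in>X. v x * f \<alpha> x) mod p = (\<Sum>x\<in>X. w x * f \<alpha> x) mod p"
      using fun_cong[OF vw(3), of \<alpha>] that by (simp add: \<Phi>_def)
    then show ?thesis
      by (simp add: left_diff_distrib sum_subtractf mod_eq_dvd_iff)
  qed
  ultimately show thesis
    using that[of "\<lambda>x. v x - w x"] x(1) by blast
qed

text \<open>While the support is too small, the preceding lemma applies to its complement and the
  solution found there can be added without cancellation.\<close>

lemma homogeneous_system_mod_large_support:
  fixes f :: "'b \<Rightarrow> 'x \<Rightarrow> int" and p :: int
  assumes p: "p > 1" and X: "finite X" and A: "finite A" and m: "m + card A \<le> card X"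
  shows "\<exists>h. (\<forall>\<alpha>\<in>A. p dvd (\<Sum>x\<in>X. h x * f \<alpha> x)) \<and> m \<le> card {x\<in>X. \<not> p dvd h x}"
  using m
proof (induction m)
  case 0
  show ?case by (rule exI[of _ "\<lambda>_. 0"]) simp
next
  case (Suc m)
  then obtain h where h: "\<forall>\<alpha>\<in>A. p dvd (\<Sum>x\<in>X. h x * f \<alpha> x)"
    and hm: "m \<le> card {x\<in>X. \<not> p dvd h x}"
    by auto
  define S where "S = {x\<in>X. \<not> p dvd h x}"
  show ?case
  proof (cases "Suc m \<le> card S")
    case True
    then show ?thesis using h by (auto simp: S_def)
  next
    case False
    have S: "S \<subseteq> X" "finite S" using X by (auto simp: S_def)
    then have "card A < card (X - S)"
      using False Suc.prems by (simp add: card_Diff_subset)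
    then obtain k where k: "\<forall>\<alpha>\<in>A. p dvd (\<Sum>x\<in>X - S. k x * f \<alpha> x)"
      and "\<exists>x\<in>X - S. \<not> p dvd k x"
      using homogeneous_system_mod_nontrivial[OF p _ A] X by (metis finite_Diff)
    then obtain x where x: "x \<in> X - S" "\<not> p dvd k x"
      by blast
    \<comment> \<open>Off \<open>S\<close> the vector \<open>h\<close> vanishes modulo
      \<open>p\<close>. So \<open>h'\<close> agrees with \<open>h\<close> on \<open>S\<close> and is
      congruent to \<open>k\<close> elsewhere: the support keeps \<open>S\<close> and gains
      \<open>x\<close>.\<close>
    define h' where "h' y = h y + (if y \<in> S then 0 else k y)" for y
    have "p dvd (\<Sum>x\<in>X. h' x * f \<alpha> x)" if "\<alpha> \<in> A" for \<alpha>
    proof -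
      have "(\<Sum>x\<in>X. h' x * f \<alpha> x)
          = (\<Sum>x\<in>X. h x * f \<alpha> x) + (\<Sum>x\<in>X. (if x \<in> S then 0 else k x) * f \<alpha> x)"
        by (simp add: h'_def distrib_right sum.distrib)
      also have "(\<Sum>x\<in>X. (if x \<in> S then 0 else k x) * f \<alpha> x) = (\<Sum>x\<in>X - S. k x * f \<alpha> x)"
        using X by (intro sum.mono_neutral_cong_right) auto
      finally show ?thesis using h k that by simp
    qed
    moreover have "insert x S \<subseteq> {x\<in>X. \<not> p dvd h' x}"
    proof -
      have "p dvd h x" using x by (auto simp: S_def)
      then have "\<not> p dvd h' x" using x by (simp add: h'_def dvd_add_right_iff)
      then show ?thesis using x(1) by (auto simp: S_def h'_def)
    qed
    then have "card (insert x S) \<le> card {x\<in>X. \<not> p dvd h' x}"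
      using X by (intro card_mono) auto
    ultimately show ?thesis
      using x(1) S hm by (intro exI[of _ h']) (simp add: S_def)
  qed
qed

section \<open>Slice rank of a diagonal tensor\<close>

text \<open>Weighting a tensor by \<open>h\<close> and \<open>k\<close> turns each slice into a
  product of two sums in one variable; it vanishes modulo \<open>p\<close> as soon as one of them
  does.\<close>

lemma sum_slice_factor:
  fixes h :: "'x \<Rightarrow> int" and k :: "'y \<Rightarrow> int"
  shows "(\<Sum>x\<in>X. \<Sum>y\<in>Y. h x * k y * (\<Sum>\<alpha>\<in>A. f \<alpha> x * f' \<alpha> y))
    = (\<Sum>\<alpha>\<in>A. (\<Sum>x\<in>X. h x * f \<alpha> x) * (\<Sum>y\<in>Y. k y * f' \<alpha> y))"
proof -
  have "(\<Sum>x\<in>X. \<Sum>y\<in>Y. h x * k y * (\<Sum>\<alpha>\<in>A. f \<alpha> x * f' \<alpha> y))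
      = (\<Sum>x\<in>X. \<Sum>y\<in>Y. \<Sum>\<alpha>\<in>A. (h x * f \<alpha> x) * (k y * f' \<alpha> y))"
    by (simp add: sum_distrib_left algebra_simps)
  also have "\<dots> = (\<Sum>x\<in>X. \<Sum>\<alpha>\<in>A. \<Sum>y\<in>Y. (h x * f \<alpha> x) * (k y * f' \<alpha> y))"
    by (intro sum.cong refl sum.swap)
  also have "\<dots> = (\<Sum>\<alpha>\<in>A. \<Sum>x\<in>X. \<Sum>y\<in>Y. (h x * f \<alpha> x) * (k y * f' \<alpha> y))"
    by (rule sum.swap)
  finally show ?thesis by (simp add: sum_product)
qed

text \<open>With too few slices, \<open>h\<close> can be chosen to annihilate the \<open>A\<close>
  slices while its support \<open>S\<close> keeps more than \<open>card B + card C\<close> points.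
  This leaves room for a \<open>k\<close> on \<open>S\<close> that annihilates all other slices. The
  weighted sum of \<open>F\<close> at a third argument \<open>z\<close> is then divisible by
  \<open>p\<close>, although diagonality reduces it to \<open>h z * k z * F z z z\<close>, which is
  not.\<close>

lemma slice_rank_diagonal:
  fixes F :: "'x \<Rightarrow> 'x \<Rightarrow> 'x \<Rightarrow> int" and p :: int
  assumes p: "prime p" and fin: "finite X" "finite A" "finite B" "finite C"
    and diag: "\<And>x y z. \<lbrakk>x \<in> X; y \<in> X; z \<in> X\<rbrakk> \<Longrightarrow> p dvd F x y z \<longleftrightarrow> \<not> (x = y \<and> y = z)"
    and slices: "\<And>x y z. \<lbrakk>x \<in> X; y \<in> X; z \<in> X\<rbrakk> \<Longrightarrow>
      F x y z = (\<Sum>\<alpha>\<in>A. f \<alpha> x * f' \<alpha> y z) + (\<Sum>\<beta>\<in>B. g \<beta> y * g' \<beta> x z) + (\<Sum>\<gamma>\<in>C. e \<gamma> z * e' \<gamma> x y)"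
  shows "card X \<le> card A + card B + card C"
proof (rule ccontr)
  assume "\<not> ?thesis"
  then have big: "card A + card B + card C < card X" by simp
  have p1: "p > 1" using p by (rule prime_gt_1_int)
  obtain h where h: "\<forall>\<alpha>\<in>A. p dvd (\<Sum>x\<in>X. h x * f \<alpha> x)"
    and hS: "card X - card A \<le> card {x\<in>X. \<not> p dvd h x}"
    using homogeneous_system_mod_large_support[OF p1 fin(1,2), of "card X - card A" f] big by auto
  define S where "S = {x\<in>X. \<not> p dvd h x}"
  have S: "S \<subseteq> X" "finite S" using fin by (auto simp: S_def)
  \<comment> \<open>The conditions on \<open>k\<close>: the \<open>B\<close> slices depend on
    \<open>y\<close> directly, the \<open>C\<close> slices only after \<open>x\<close> has been
    summed out against \<open>h\<close>. With \<open>z\<close> fixed, the factor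
    \<open>e \<gamma> z\<close> is a mere constant.\<close>
  define \<phi> where "\<phi> i y = (case i of Inl \<beta> \<Rightarrow> g \<beta> y | Inr \<gamma> \<Rightarrow> \<Sum>x\<in>X. h x * e' \<gamma> x y)" for i y
  have "card (B <+> C) < card S"
    using hS big fin by (simp add: S_def card_Plus)
  then obtain k where k: "\<forall>i\<in>B <+> C. p dvd (\<Sum>y\<in>S. k y * \<phi> i y)"
    and "\<exists>z\<in>S. \<not> p dvd k z"
    using homogeneous_system_mod_nontrivial[OF p1 S(2)] fin by (metis finite_Plus)
  then obtain z where z: "z \<in> S" "\<not> p dvd k z" by blast
  have zX: "z \<in> X" using z S by auto
  have kB: "p dvd (\<Sum>y\<in>S. k y * g \<beta> y)" if "\<beta> \<in> B" for \<beta>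
    using bspec[OF k InlI[OF that]] by (simp add: \<phi>_def)
  have kC: "p dvd (\<Sum>y\<in>S. k y * (\<Sum>x\<in>X. h x * e' \<gamma> x y))" if "\<gamma> \<in> C" for \<gamma>
    using bspec[OF k InrI[OF that]] by (simp add: \<phi>_def)
  let ?T = "\<Sum>x\<in>X. \<Sum>y\<in>S. h x * k y * F x y z"
  have "?T = (\<Sum>x\<in>X. \<Sum>y\<in>S. h x * k y * (\<Sum>\<alpha>\<in>A. f \<alpha> x * f' \<alpha> y z))
      + (\<Sum>x\<in>X. \<Sum>y\<in>S. h x * k y * (\<Sum>\<beta>\<in>B. g' \<beta> x z * g \<beta> y))
      + (\<Sum>x\<in>X. \<Sum>y\<in>S. h x * k y * (\<Sum>\<gamma>\<in>C. e \<gamma> z * e' \<gamma> x y))"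
    unfolding sum.distrib[symmetric]
    by (intro sum.cong refl) (use S zX in \<open>auto simp: slices algebra_simps\<close>)
  also have "(\<Sum>x\<in>X. \<Sum>y\<in>S. h x * k y * (\<Sum>\<alpha>\<in>A. f \<alpha> x * f' \<alpha> y z))
      = (\<Sum>\<alpha>\<in>A. (\<Sum>x\<in>X. h x * f \<alpha> x) * (\<Sum>y\<in>S. k y * f' \<alpha> y z))"
    by (rule sum_slice_factor)
  also have "(\<Sum>x\<in>X. \<Sum>y\<in>S. h x * k y * (\<Sum>\<beta>\<in>B. g' \<beta> x z * g \<beta> y))
      = (\<Sum>\<beta>\<in>B. (\<Sum>x\<in>X. h x * g' \<beta> x z) * (\<Sum>y\<in>S. k y * g \<beta> y))"
    by (rule sum_slice_factor)
  also have "(\<Sum>x\<in>X. \<Sum>y\<in>S. h x * k y * (\<Sum>\<gamma>\<in>C. e \<gamma> z * e' \<gamma> x y))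
      = (\<Sum>y\<in>S. \<Sum>x\<in>X. \<Sum>\<gamma>\<in>C. e \<gamma> z * (k y * (h x * e' \<gamma> x y)))"
    by (subst sum.swap) (simp add: sum_distrib_left algebra_simps)
  also have "\<dots> = (\<Sum>y\<in>S. \<Sum>\<gamma>\<in>C. \<Sum>x\<in>X. e \<gamma> z * (k y * (h x * e' \<gamma> x y)))"
    by (intro sum.cong refl sum.swap)
  also have "\<dots> = (\<Sum>\<gamma>\<in>C. \<Sum>y\<in>S. \<Sum>x\<in>X. e \<gamma> z * (k y * (h x * e' \<gamma> x y)))"
    by (rule sum.swap)
  also have "\<dots> = (\<Sum>\<gamma>\<in>C. e \<gamma> z * (\<Sum>y\<in>S. k y * (\<Sum>x\<in>X. h x * e' \<gamma> x y)))"
    by (simp add: sum_distrib_left)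
  finally have "p dvd ?T"
    using h kB kC by (simp add: dvd_sum)
  have "?T = (\<Sum>(x, y)\<in>X \<times> S. h x * k y * F x y z)"
    by (simp add: sum.cartesian_product)
  \<comment> \<open>By diagonality \<open>(z, z)\<close> is the only pair whose term can survive
    modulo \<open>p\<close>.\<close>
  also have "\<dots> = h z * k z * F z z z + (\<Sum>(x, y)\<in>X \<times> S - {(z, z)}. h x * k y * F x y z)"
    using fin S z zX by (subst sum.remove[of _ "(z, z)"]) auto
  finally have "?T = h z * k z * F z z z + (\<Sum>(x, y)\<in>X \<times> S - {(z, z)}. h x * k y * F x y z)" .
  moreover have "p dvd (\<Sum>(x, y)\<in>X \<times> S - {(z, z)}. h x * k y * F x y z)"
    using S zX by (intro dvd_sum) (auto intro!: dvd_mult simp: diag)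
  ultimately have "p dvd h z * k z * F z z z"
    using \<open>p dvd ?T\<close> by (simp add: dvd_add_left_iff)
  then show False
    using p z zX diag[of z z z] by (auto simp: prime_dvd_mult_iff S_def)
qed

section \<open>Binomial coefficients modulo \<open>p\<close> and their expansion\<close>

lemma prime_dvd_if_prime_power_mult_eq:
  fixes p :: nat
  assumes p: "prime p" and eq: "p ^ e * b = N * c" and N: "\<not> p ^ e dvd N"
  shows "p dvd c"
proof (rule ccontr)
  assume "\<not> p dvd c"
  then have "coprime (p ^ e) c"
    using p by (simp add: prime_imp_coprime)
  moreover have "p ^ e dvd N * c"
    using eq by (metis dvd_triv_left)
  ultimately show False
    using N by (simp add: coprime_dvd_mult_left_iff)
qed

text \<open>If \<open>q\<close> does not divide \<open>N\<close>, the absorption identity writes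
  \<open>N\<close> times the coefficient as a multiple of \<open>q\<close>, which forces a factor
  \<open>p\<close> into the coefficient. If \<open>q\<close> divides \<open>N\<close>, the same
  argument makes \<open>p\<close> divide \<open>N choose k\<close> for \<open>0 < k < q\<close>, so
  Vandermonde's sum is congruent to its term 1 at \<open>k = 0\<close>.\<close>

lemma prime_dvd_binomial_pred_prime_power_iff:
  fixes p e N :: nat
  assumes p: "prime p"
  defines "q \<equiv> p ^ e"
  shows "p dvd (N + (q - 1) choose (q - 1)) \<longleftrightarrow> \<not> q dvd N"
proof
  have q: "q > 0" using p by (simp add: q_def prime_gt_0_nat)
  show "p dvd (N + (q - 1) choose (q - 1))" if "\<not> q dvd N"
  proof -
    have "q * (N + (q - 1) choose q) = N * (N + (q - 1) choose (q - 1))"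
      using times_binomial_minus1_eq[OF q, of "N + (q - 1)"]
        binomial_absorb_comp[of "N + (q - 1)" "q - 1"]
      by simp
    then show ?thesis
      using prime_dvd_if_prime_power_mult_eq[OF p] that unfolding q_def by blast
  qed
  show "\<not> q dvd N" if "p dvd (N + (q - 1) choose (q - 1))"
  proof
    assume "q dvd N"
    let ?t = "\<lambda>k. (N choose k) * (q - 1 choose (q - 1 - k))"
    have "N + (q - 1) choose (q - 1) = (\<Sum>k\<le>q - 1. ?t k)"
      by (rule vandermonde[symmetric])
    also have "\<dots> = 1 + (\<Sum>k\<in>{..q - 1} - {0}. ?t k)"
      by (subst sum.remove[of _ 0]) auto
    finally have eq: "N + (q - 1) choose (q - 1) = 1 + (\<Sum>k\<in>{..q - 1} - {0}. ?t k)" .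
    have rest: "p dvd (\<Sum>k\<in>{..q - 1} - {0}. ?t k)"
    proof (rule dvd_sum)
      fix k assume k: "k \<in> {..q - 1} - {0}"
      then have "0 < k" "k < q" using q by auto
      then have "\<not> q dvd k" by (simp add: nat_dvd_not_less)
      obtain m where m: "N = q * m" using \<open>q dvd N\<close> by blast
      have "q * (m * (N - 1 choose (k - 1))) = k * (N choose k)"
        using times_binomial_minus1_eq[OF \<open>0 < k\<close>, of N] by (simp add: m)
      then have "p dvd (N choose k)"
        using prime_dvd_if_prime_power_mult_eq[OF p, of e] \<open>\<not> q dvd k\<close>
        by (simp add: q_def)
      then show "p dvd ?t k" by simp
    qed
    have "p dvd 1" using that unfolding eq dvd_add_left_iff[OF rest] .
    then show False using p by simp
  qed
qed

text \<open>Vandermonde's identity is applied three times, with \<open>r\<close> as the fourth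
  summand. Padding with zeros to the full box \<open>{..r}\<close> in each index makes the ranges
  independent, as \<open>sum_PiE3_prod\<close> requires.\<close>

lemma vandermonde3:
  "(x + y + z + r) choose r = (\<Sum>a\<le>r. \<Sum>b\<le>r. \<Sum>c\<le>r.
     (if a + b + c \<le> r then r choose (r - (a + b + c)) else 0) * ((x choose a) * (y choose b) * (z choose c)))"
proof -
  have "(x + y + z + r) choose r = (\<Sum>a\<le>r. (x choose a) * ((y + (z + r)) choose (r - a)))"
    unfolding vandermonde by (simp add: add.assoc)
  also have "\<dots> = (\<Sum>a\<le>r. \<Sum>b\<le>r - a. \<Sum>c\<le>r - a - b.
      (x choose a) * ((y choose b) * ((z choose c) * (r choose (r - a - b - c)))))"
    by (simp only: vandermonde[symmetric] sum_distrib_left)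
  also have "\<dots> = (\<Sum>a\<le>r. \<Sum>b\<le>r. \<Sum>c\<le>r.
     (if a + b + c \<le> r then r choose (r - (a + b + c)) else 0) * ((x choose a) * (y choose b) * (z choose c)))"
  proof (rule sum.cong[OF refl])
    fix a assume a: "a \<in> {..r}"
    show "(\<Sum>b\<le>r - a. \<Sum>c\<le>r - a - b.
      (x choose a) * ((y choose b) * ((z choose c) * (r choose (r - a - b - c)))))
      = (\<Sum>b\<le>r. \<Sum>c\<le>r.
     (if a + b + c \<le> r then r choose (r - (a + b + c)) else 0) * ((x choose a) * (y choose b) * (z choose c)))"
    proof (rule sum.mono_neutral_cong_left)
      fix b assume b: "b \<in> {..r - a}"
      show "(\<Sum>c\<le>r - a - b.
        (x choose a) * ((y choose b) * ((z choose c) * (r choose (r - a - b - c)))))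
      = (\<Sum>c\<le>r. (if a + b + c \<le> r then r choose (r - (a + b + c)) else 0) * ((x choose a) * (y choose b) * (z choose c)))"
        using a b by (intro sum.mono_neutral_cong_left) auto
    qed (use a in auto)
  qed
  finally show ?thesis .
qed

lemma sum_PiE3_prod:
  fixes g :: "'i \<Rightarrow> 'd \<Rightarrow> 'd \<Rightarrow> 'd \<Rightarrow> 'c :: comm_semiring_1"
  assumes "finite I" "finite D"
  shows "(\<Prod>i\<in>I. \<Sum>a\<in>D. \<Sum>b\<in>D. \<Sum>c\<in>D. g i a b c)
    = (\<Sum>a\<in>I \<rightarrow>\<^sub>E D. \<Sum>b\<in>I \<rightarrow>\<^sub>E D. \<Sum>c\<in>I \<rightarrow>\<^sub>E D. \<Prod>i\<in>I. g i (a i) (b i) (c i))"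
  using assms by (simp add: prod_sum_PiE)

text \<open>A triple with \<open>P a b c = 0\<close> unless one of its entries lies in \<open>L\<close> is charged
  to the first such entry.\<close>

lemma sum3_split_slices:
  fixes \<kappa> :: "'d \<Rightarrow> 'd \<Rightarrow> 'd \<Rightarrow> int"
  assumes fin: "finite D" and L: "L \<subseteq> D"
    and zero: "\<And>a b c. \<lbrakk>a \<in> D - L; b \<in> D - L; c \<in> D - L\<rbrakk> \<Longrightarrow> \<kappa> a b c = 0"
  shows "(\<Sum>a\<in>D. \<Sum>b\<in>D. \<Sum>c\<in>D. \<kappa> a b c * (u a * v b * w c))
    = (\<Sum>a\<in>L. u a * (\<Sum>b\<in>D. \<Sum>c\<in>D. \<kappa> a b c * (v b * w c)))
    + (\<Sum>b\<in>L. v b * (\<Sum>a\<in>D - L. \<Sum>c\<in>D. \<kappa> a b c * (u a * w c)))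
    + (\<Sum>c\<in>L. w c * (\<Sum>a\<in>D - L. \<Sum>b\<in>D - L. \<kappa> a b c * (u a * v b)))"
proof -
  let ?t = "\<lambda>a b c. \<kappa> a b c * (u a * v b * w c)"
  have split: "sum \<psi> D = sum \<psi> L + sum \<psi> (D - L)" for \<psi> :: "'d \<Rightarrow> int"
    using sum.subset_diff[OF L fin, of \<psi>] by simp
  have 1: "(\<Sum>a\<in>L. \<Sum>b\<in>D. \<Sum>c\<in>D. ?t a b c)
      = (\<Sum>a\<in>L. u a * (\<Sum>b\<in>D. \<Sum>c\<in>D. \<kappa> a b c * (v b * w c)))"
    by (simp add: sum_distrib_left algebra_simps)
  have "(\<Sum>a\<in>D - L. \<Sum>b\<in>L. \<Sum>c\<in>D. ?t a b c) = (\<Sum>b\<in>L. \<Sum>a\<in>D - L. \<Sum>c\<in>D. ?t a b c)"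
    by (rule sum.swap)
  also have "\<dots> = (\<Sum>b\<in>L. v b * (\<Sum>a\<in>D - L. \<Sum>c\<in>D. \<kappa> a b c * (u a * w c)))"
    by (simp add: sum_distrib_left algebra_simps)
  finally have 2: "(\<Sum>a\<in>D - L. \<Sum>b\<in>L. \<Sum>c\<in>D. ?t a b c)
      = (\<Sum>b\<in>L. v b * (\<Sum>a\<in>D - L. \<Sum>c\<in>D. \<kappa> a b c * (u a * w c)))" .
  have "(\<Sum>a\<in>D - L. \<Sum>b\<in>D - L. \<Sum>c\<in>D. ?t a b c) = (\<Sum>a\<in>D - L. \<Sum>b\<in>D - L. \<Sum>c\<in>L. ?t a b c)"
    by (intro sum.cong refl sum.mono_neutral_right fin L) (auto simp: zero)
  also have "\<dots> = (\<Sum>a\<in>D - L. \<Sum>c\<in>L. \<Sum>b\<in>D - L. ?t a b c)"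
    by (intro sum.cong refl sum.swap)
  also have "\<dots> = (\<Sum>c\<in>L. \<Sum>a\<in>D - L. \<Sum>b\<in>D - L. ?t a b c)"
    by (rule sum.swap)
  also have "\<dots> = (\<Sum>c\<in>L. w c * (\<Sum>a\<in>D - L. \<Sum>b\<in>D - L. \<kappa> a b c * (u a * v b)))"
    by (simp add: sum_distrib_left algebra_simps)
  finally have 3: "(\<Sum>a\<in>D - L. \<Sum>b\<in>D - L. \<Sum>c\<in>D. ?t a b c)
      = (\<Sum>c\<in>L. w c * (\<Sum>a\<in>D - L. \<Sum>b\<in>D - L. \<kappa> a b c * (u a * v b)))" .
  have "(\<Sum>a\<in>D. \<Sum>b\<in>D. \<Sum>c\<in>D. ?t a b c)
      = (\<Sum>a\<in>L. \<Sum>b\<in>D. \<Sum>c\<in>D. ?t a b c) + (\<Sum>a\<in>D - L. \<Sum>b\<in>D. \<Sum>c\<in>D. ?t a b c)"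
    by (rule split)
  also have "(\<Sum>a\<in>D - L. \<Sum>b\<in>D. \<Sum>c\<in>D. ?t a b c)
      = (\<Sum>a\<in>D - L. \<Sum>b\<in>L. \<Sum>c\<in>D. ?t a b c) + (\<Sum>a\<in>D - L. \<Sum>b\<in>D - L. \<Sum>c\<in>D. ?t a b c)"
    by (subst split[of "\<lambda>b. \<Sum>c\<in>D. ?t _ b c"]) (simp add: sum.distrib)
  finally show ?thesis by (simp add: 1 2 3)
qed

section \<open>From divisibility conditions to exponent vectors\<close>

text \<open>The bound is a third of \<open>n * r\<close>, the largest total degree of three exponent
  vectors together, with the denominator cleared to stay in the naturals.\<close>

definition low_exponents :: "nat \<Rightarrow> nat \<Rightarrow> (nat \<Rightarrow> nat) set" where
  "low_exponents r n = {a \<in> {..<n} \<rightarrow>\<^sub>E {..r}. 3 * (\<Sum>i<n. a i) \<le> n * r}"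

lemma card_le_low_exponents:
  fixes x y z :: "'m \<Rightarrow> nat \<Rightarrow> nat" and p e n :: nat
  assumes p: "prime p" and M: "finite M"
  defines "q \<equiv> p ^ e"
  assumes matching: "\<And>l m k. \<lbrakk>l \<in> M; m \<in> M; k \<in> M\<rbrakk> \<Longrightarrow>
    (\<forall>i<n. q dvd x l i + y m i + z k i) \<longleftrightarrow> l = m \<and> m = k"
  shows "card M \<le> 3 * card (low_exponents (q - 1) n)"
proof -
  define r where "r = q - 1"
  define D where "D = {..<n} \<rightarrow>\<^sub>E {..r}"
  define L where "L = low_exponents r n"
  have fin: "finite D" by (simp add: D_def finite_PiE)
  have L: "L \<subseteq> D" by (auto simp: L_def low_exponents_def D_def)
  \<comment> \<open>Products of binomials \<open>\<chi>\<close> serve in place of monomials: in them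
    the coefficients \<open>\<kappa>\<close> are integers, whereas the power basis would bring in
    denominators divisible by \<open>p\<close> when \<open>e > 1\<close>.\<close>
  define c where "c a b d = (if a + b + d \<le> r then int (r choose (r - (a + b + d))) else 0)" for a b d
  define \<kappa> where "\<kappa> a b d = (\<Prod>i<n. c (a i) (b i) (d i))" for a b d :: "nat \<Rightarrow> nat"
  define \<chi> where "\<chi> s a = (\<Prod>i<n. int (s i choose a i))" for s a :: "nat \<Rightarrow> nat"
  define F where "F l m k = (\<Prod>i<n. int ((x l i + y m i + z k i + r) choose r))" for l m k
  have high: "n * r < 3 * (\<Sum>i<n. a i)" if "a \<in> D - L" for a
    using that by (simp add: L_def low_exponents_def D_def not_le)
  have zero: "\<kappa> a b d = 0" if "a \<in> D - L" "b \<in> D - L" "d \<in> D - L" for a b d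
  proof -
    \<comment> \<open>The three bounds from \<open>high\<close> add up to this after division by 3.
      Hence some coordinate has exponents of total above \<open>r\<close>, and there the factor
      \<open>c\<close> is 0.\<close>
    have "n * r < (\<Sum>i<n. a i + b i + d i)"
      using that[THEN high] by (simp add: sum.distrib)
    then obtain i where "i < n" "r < a i + b i + d i"
      using sum_mono[of "{..<n}" "\<lambda>i. a i + b i + d i" "\<lambda>_. r"] by (force simp: not_le)
    then show ?thesis by (force simp: \<kappa>_def c_def)
  qed
  have F: "F l m k = (\<Sum>a\<in>D. \<Sum>b\<in>D. \<Sum>d\<in>D. \<kappa> a b d * (\<chi> (x l) a * \<chi> (y m) b * \<chi> (z k) d))" for l m k
  proof -
    have "F l m k = (\<Prod>i<n. \<Sum>a\<le>r. \<Sum>b\<le>r. \<Sum>d\<le>r.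
       c a b d * (int (x l i choose a) * int (y m i choose b) * int (z k i choose d)))"
      unfolding F_def vandermonde3 c_def of_nat_sum of_nat_mult
      by (intro prod.cong sum.cong refl) auto
    then show ?thesis
      by (simp add: sum_PiE3_prod D_def \<kappa>_def \<chi>_def prod.distrib)
  qed
  have "card M \<le> card L + card L + card L"
  proof (rule slice_rank_diagonal[where F = F and p = "int p"])
    show "int p dvd F l m k \<longleftrightarrow> \<not> (l = m \<and> m = k)" if "l \<in> M" "m \<in> M" "k \<in> M" for l m k
    proof -
      have "int p dvd F l m k \<longleftrightarrow> (\<exists>i<n. int p dvd int ((x l i + y m i + z k i + r) choose r))"
        using p unfolding F_def by (subst prime_dvd_prod_iff) auto
      also have "\<dots> \<longleftrightarrow> (\<exists>i<n. \<not> q dvd x l i + y m i + z k i)"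
        using prime_dvd_binomial_pred_prime_power_iff[OF p, of _ e]
        by (simp add: q_def r_def)
      finally show ?thesis using matching[OF that] by auto
    qed
    show "F l m k =
        (\<Sum>a\<in>L. \<chi> (x l) a * (\<Sum>b\<in>D. \<Sum>d\<in>D. \<kappa> a b d * (\<chi> (y m) b * \<chi> (z k) d)))
      + (\<Sum>b\<in>L. \<chi> (y m) b * (\<Sum>a\<in>D - L. \<Sum>d\<in>D. \<kappa> a b d * (\<chi> (x l) a * \<chi> (z k) d)))
      + (\<Sum>d\<in>L. \<chi> (z k) d * (\<Sum>a\<in>D - L. \<Sum>b\<in>D - L. \<kappa> a b d * (\<chi> (x l) a * \<chi> (y m) b)))"
      for l m k
      unfolding F by (rule sum3_split_slices[OF fin L zero])
  qed (use p M finite_subset[OF L fin] in auto)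
  then show ?thesis by (simp add: L_def r_def)
qed

section \<open>Counting the low exponent vectors\<close>

text \<open>Markov's inequality with the weight \<open>t ^ (a\<^sub>1 + \<dots> + a\<^sub>n)\<close> for \<open>t = 2 powr (-1 / r)\<close>: by convexity
  the mean of \<open>1, t, \<dots>, t ^ r\<close> is at most the mean \<open>3 / 4\<close> of \<open>1\<close> and \<open>t ^ r\<close>. The function \<open>w\<close> carries the
  normalisation \<open>t ^ (- r / 3)\<close>.\<close>

lemma card_low_exponents_le:
  assumes r: "r > 0"
  shows "real (card (low_exponents r n)) \<le> (real (r + 1) * (3 / 4 * 2 powr (1 / 3))) ^ n"
proof -
  let ?D = "{..<n} \<rightarrow>\<^sub>E {..r}"
  define w where "w j = (1 / 2) powr (real j / real r - 1 / 3)" for j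
  have fin: "finite ?D" by (simp add: finite_PiE)
  have w: "w j = (1 / 2) powr (real j / real r) * 2 powr (1 / 3)" for j
    by (simp add: w_def powr_diff powr_divide)
  have "1 \<le> (\<Prod>i<n. w (a i))" if "a \<in> low_exponents r n" for a
  proof -
    have "3 * (\<Sum>i<n. a i) \<le> n * r" using that by (simp add: low_exponents_def)
    then have "3 * (\<Sum>i<n. real (a i)) \<le> real n * real r"
      by (metis of_nat_le_iff of_nat_mult of_nat_numeral of_nat_sum)
    \<comment> \<open>On a low vector the mean of \<open>a i / r\<close> is at most 1/3, so the
      total exponent of 1/2 is nonpositive and the weight is at least 1.\<close>
    then have "(\<Sum>i<n. real (a i) / real r - 1 / 3) \<le> 0"
      using r by (simp add: sum_subtractf flip: sum_divide_distrib) (simp add: field_simps)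
    then have "(1 / 2 :: real) powr 0 \<le> (1 / 2) powr (\<Sum>i<n. real (a i) / real r - 1 / 3)"
      by (intro powr_mono') auto
    then show ?thesis
      by (simp add: w_def powr_sum)
  qed
  then have "real (card (low_exponents r n)) \<le> (\<Sum>a\<in>low_exponents r n. \<Prod>i<n. w (a i))"
    using sum_mono[of "low_exponents r n" "\<lambda>_. 1 :: real"] by simp
  also have "\<dots> \<le> (\<Sum>a\<in>?D. \<Prod>i<n. w (a i))"
    using fin by (intro sum_mono2 prod_nonneg) (auto simp: low_exponents_def w_def)
  also have "\<dots> = (\<Sum>j\<le>r. w j) ^ n"
    using prod_sum_PiE[of "{..<n}" "\<lambda>_. {..r}" "\<lambda>_. w"] by simp
  also have "\<dots> \<le> (real (r + 1) * (3 / 4 * 2 powr (1 / 3))) ^ n"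
  proof (rule power_mono)
    have "(\<Sum>j\<le>r. w j) \<le> (\<Sum>j\<le>r. (1 - real j / (2 * real r)) * 2 powr (1 / 3))"
    proof (rule sum_mono)
      fix j assume "j \<in> {..r}"
      \<comment> \<open>Weighted AM-GM for 1 and 1/2 with weights \<open>1 - j / r\<close> and
        \<open>j / r\<close>: the exponential lies below its chord.\<close>
      then have "1 powr (1 - real j / real r) * (1 / 2) powr (real j / real r)
          \<le> (1 - real j / real r) * 1 + (real j / real r) * (1 / 2)"
        using r by (intro Youngs_inequality_0) auto
      then have "(1 / 2) powr (real j / real r) \<le> 1 - real j / (2 * real r)"
        by (simp add: field_simps)
      then show "w j \<le> (1 - real j / (2 * real r)) * 2 powr (1 / 3)"
        unfolding w by (intro mult_right_mono) auto
    qed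
    also have "\<dots> = (\<Sum>j\<le>r. 1 - real j / (2 * real r)) * 2 powr (1 / 3)"
      by (simp add: sum_distrib_right)
    also have "(\<Sum>j\<le>r. 1 - real j / (2 * real r)) = real (r + 1) * (3 / 4)"
    proof -
      have "(\<Sum>j\<le>r. real j) = real r * (real r + 1) / 2"
        by (induction r) (auto simp: field_simps)
      then show ?thesis
        using r by (simp add: sum_subtractf flip: sum_divide_distrib) (simp add: field_simps)
    qed
    finally show "(\<Sum>j\<le>r. w j) \<le> real (r + 1) * (3 / 4 * 2 powr (1 / 3))"
      by (simp only: mult.assoc)
  qed (auto intro!: sum_nonneg simp: w_def)
  finally show ?thesis .
qed

text \<open>Raising \<open>q\<close> to the power \<open>- tsf_delta / ln q\<close> gives
  \<open>exp (- tsf_delta)\<close>, which is exactly the factor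
  \<open>3 / 4 * 2 powr (1 / 3)\<close> lost per coordinate in the count.\<close>

lemma tsf_delta_powr:
  assumes q: "q > 1"
  shows "real q powr (1 - tsf_delta / ln (real q)) = real q * (3 / 4 * 2 powr (1 / 3))"
proof -
  have "real q powr (1 - tsf_delta / ln (real q)) = exp (ln (real q) - tsf_delta)"
    using q by (simp add: powr_def field_simps)
  also have "\<dots> = real q / ((2 / 3) * 2 powr (2 / 3))"
    using q by (simp add: exp_diff tsf_delta_def)
  also have "1 / ((2 / 3) * 2 powr (2 / 3)) = 3 / 4 * (2 :: real) powr (1 / 3)"
  proof -
    have "(2 :: real) powr (1 / 3) * 2 powr (2 / 3) = 2 powr (1 / 3 + 2 / 3)"
      by (rule powr_add[symmetric])
    then show ?thesis by (simp add: field_simps)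
  qed
  then have "real q / ((2 / 3) * 2 powr (2 / 3)) = real q * (3 / 4 * 2 powr (1 / 3))"
    by (metis times_divide_eq_right mult.right_neutral)
  finally show ?thesis .
qed

section \<open>Tricolored sum-free sets in the group\<close>

lemma tricolored_sum_freeE:
  assumes "tricolored_sum_free H M"
  obtains S T U where "M \<subseteq> S \<times> T \<times> U"
    and "S \<subseteq> carrier H" "T \<subseteq> carrier H" "U \<subseteq> carrier H"
    and "inj_on (\<lambda>(s, t, u). s) M" "inj_on (\<lambda>(s, t, u). t) M" "inj_on (\<lambda>(s, t, u). u) M"
    and "\<forall>(s, t, u) \<in> M. s \<otimes>\<^bsub>H\<^esub> t \<otimes>\<^bsub>H\<^esub> u = \<one>\<^bsub>H\<^esub>"
    and "\<forall>(s, t, u) \<in> (S \<times> T \<times> U) - M. s \<otimes>\<^bsub>H\<^esub> t \<otimes>\<^bsub>H\<^esub> u \<noteq> \<one>\<^bsub>H\<^esub>"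
  using assms unfolding tricolored_sum_free_def perfect_matching3_def bij_betw_def
  by (elim exE conjE) (rule that; assumption)

text \<open>This makes the zero-sum relation diagonal on \<open>M\<close>. The mixed triple lies in
  \<open>S \<times> T \<times> U\<close>, so it sums to zero exactly if it belongs to
  \<open>M\<close>; it then shares one coordinate with each of \<open>l\<close>, \<open>m\<close>,
  \<open>k\<close> and equals all three by injectivity of the projections.\<close>

lemma tricolored_sum_free_triple_iff:
  assumes M: "tricolored_sum_free H M" and mem: "l \<in> M" "m \<in> M" "k \<in> M"
  shows "fst l \<otimes>\<^bsub>H\<^esub> fst (snd m) \<otimes>\<^bsub>H\<^esub> snd (snd k) = \<one>\<^bsub>H\<^esub> \<longleftrightarrow> l = m \<and> m = k"
proof -
  obtain S T U where MS: "M \<subseteq> S \<times> T \<times> U"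
    and inj: "inj_on (\<lambda>(s, t, u). s) M" "inj_on (\<lambda>(s, t, u). t) M" "inj_on (\<lambda>(s, t, u). u) M"
    and zero: "\<forall>(s, t, u) \<in> M. s \<otimes>\<^bsub>H\<^esub> t \<otimes>\<^bsub>H\<^esub> u = \<one>\<^bsub>H\<^esub>"
    and nonzero: "\<forall>(s, t, u) \<in> (S \<times> T \<times> U) - M. s \<otimes>\<^bsub>H\<^esub> t \<otimes>\<^bsub>H\<^esub> u \<noteq> \<one>\<^bsub>H\<^esub>"
    using M by (rule tricolored_sum_freeE)
  let ?w = "(fst l, fst (snd m), snd (snd k))"
  have "?w \<in> S \<times> T \<times> U" using MS mem by auto
  then have "fst l \<otimes>\<^bsub>H\<^esub> fst (snd m) \<otimes>\<^bsub>H\<^esub> snd (snd k) = \<one>\<^bsub>H\<^esub> \<longleftrightarrow> ?w \<in> M"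
    using bspec[OF zero, of ?w] bspec[OF nonzero, of ?w] by auto
  also have "\<dots> \<longleftrightarrow> l = m \<and> m = k"
  proof
    assume w: "?w \<in> M"
    have "?w = l" by (rule inj_onD[OF inj(1) _ w mem(1)]) (simp add: split_beta)
    moreover have "?w = m" by (rule inj_onD[OF inj(2) _ w mem(2)]) (simp add: split_beta)
    moreover have "?w = k" by (rule inj_onD[OF inj(3) _ w mem(3)]) (simp add: split_beta)
    ultimately show "l = m \<and> m = k" by metis
  qed (use mem in auto)
  finally show ?thesis .
qed

theorem mainTheorem2:
  fixes H :: "('a, 'm) monoid_scheme" and q n :: nat and M :: "('a \<times> 'a \<times> 'a) set"
  assumes "comm_group H"
    and "primepow q"
    and "H \<cong> product_group {..<n} (\<lambda>_. integer_mod_group q)"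
    and "tricolored_sum_free H M"
  shows "real (card M) \<le> 3 * real (order H) powr (1 - tsf_delta / ln (real q))"
proof -
  obtain p e where p: "prime p" and e: "e > 0" and q: "q = p ^ e"
    using assms(2) by (auto simp: primepow_def)
  have q1: "q > 1" using primepow_gt_Suc_0[OF assms(2)] by simp
  let ?G = "product_group {..<n} (\<lambda>_. integer_mod_group q)"
  interpret H: comm_group H by fact
  have G: "group ?G" by simp
  have carr: "carrier ?G = {..<n} \<rightarrow>\<^sub>E {0..<int q}"
    using q1 by (simp add: carrier_integer_mod_group)
  obtain \<phi> where \<phi>: "\<phi> \<in> iso H ?G"
    using assms(3) by (auto simp: is_iso_def)
  then have bij: "bij_betw \<phi> (carrier H) (carrier ?G)" and hom: "\<phi> \<in> hom H ?G"
    by (auto simp: iso_def)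
  have order: "order H = q ^ n"
    using bij_betw_same_card[OF bij] unfolding order_def carr by (simp add: card_PiE)
  then have finH: "finite (carrier H)"
    using q1 by (metis H.order_gt_0_iff_finite zero_less_power less_trans zero_less_one)
  have MH: "M \<subseteq> carrier H \<times> carrier H \<times> carrier H"
    using assms(4) by (rule tricolored_sum_freeE) blast
  have finM: "finite M"
    using finite_subset[OF MH] finH by simp
  \<comment> \<open>Since \<open>q > 1\<close>, the coordinates of \<open>\<phi> s\<close> lie in
    \<open>{0..<int q}\<close> for \<open>s\<close> in the carrier, so \<open>nat\<close> loses
    nothing and addition modulo \<open>q\<close> becomes divisibility of natural number
    sums.\<close>
  define c where "c s i = nat (\<phi> s i)" for s i
  have sum_iff: "s \<otimes>\<^bsub>H\<^esub> t \<otimes>\<^bsub>H\<^esub> u = \<one>\<^bsub>H\<^esub> \<longleftrightarrow> (\<forall>i<n. q dvd c s i + c t i + c u i)"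
    if "s \<in> carrier H" "t \<in> carrier H" "u \<in> carrier H" for s t u
  proof -
    have one: "\<phi> \<one>\<^bsub>H\<^esub> = \<one>\<^bsub>?G\<^esub>"
      by (rule hom_one[OF hom]) (use G in auto)
    have c: "\<phi> v i = int (c v i)" if "v \<in> carrier H" "i < n" for v i
    proof -
      have "\<phi> v \<in> {..<n} \<rightarrow>\<^sub>E {0..<int q}"
        using bij_betwE[OF bij] that(1) unfolding carr by blast
      then have "\<phi> v i \<in> {0..<int q}"
        by (rule PiE_mem) (use that(2) in simp)
      then show ?thesis by (simp add: c_def)
    qed
    have "s \<otimes>\<^bsub>H\<^esub> t \<otimes>\<^bsub>H\<^esub> u = \<one>\<^bsub>H\<^esub> \<longleftrightarrow> \<phi> (s \<otimes>\<^bsub>H\<^esub> t \<otimes>\<^bsub>H\<^esub> u) = \<phi> \<one>\<^bsub>H\<^esub>"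
      using inj_on_eq_iff[OF bij_betw_imp_inj_on[OF bij]] that by simp
    also have "\<phi> (s \<otimes>\<^bsub>H\<^esub> t \<otimes>\<^bsub>H\<^esub> u) = \<phi> s \<otimes>\<^bsub>?G\<^esub> \<phi> t \<otimes>\<^bsub>?G\<^esub> \<phi> u"
      using that by (simp only: hom_mult[OF hom] H.m_closed)
    also have "\<phi> s \<otimes>\<^bsub>?G\<^esub> \<phi> t \<otimes>\<^bsub>?G\<^esub> \<phi> u = \<phi> \<one>\<^bsub>H\<^esub>
        \<longleftrightarrow> (\<forall>i<n. (\<phi> s i + \<phi> t i + \<phi> u i) mod int q = 0)"
      unfolding one by (auto simp: fun_eq_iff restrict_def mod_add_left_eq)
    also have "\<dots> \<longleftrightarrow> (\<forall>i<n. q dvd c s i + c t i + c u i)"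
      using that by (simp add: c flip: dvd_eq_mod_eq_0 of_nat_add)
    finally show ?thesis .
  qed
  have "card M \<le> 3 * card (low_exponents (q - 1) n)"
    unfolding q
  proof (rule card_le_low_exponents[OF p finM])
    fix l m k assume lmk: "l \<in> M" "m \<in> M" "k \<in> M"
    then have "fst l \<in> carrier H" "fst (snd m) \<in> carrier H" "snd (snd k) \<in> carrier H"
      using MH by auto
    from sum_iff[OF this] tricolored_sum_free_triple_iff[OF assms(4) lmk]
    show "(\<forall>i<n. p ^ e dvd c (fst l) i + c (fst (snd m)) i + c (snd (snd k)) i) \<longleftrightarrow> l = m \<and> m = k"
      by (simp add: q)
  qed
  then have "real (card M) \<le> 3 * real (card (low_exponents (q - 1) n))"
    by (metis of_nat_le_iff of_nat_mult of_nat_numeral)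
  also have "\<dots> \<le> 3 * (real q * (3 / 4 * 2 powr (1 / 3))) ^ n"
    using card_low_exponents_le[of "q - 1" n] q1 by simp
  also have "\<dots> = 3 * (real q powr (1 - tsf_delta / ln (real q))) ^ n"
    by (simp only: tsf_delta_powr[OF q1])
  \<comment> \<open>As \<open>order H = q ^ n\<close>, the outer power \<open>n\<close> moves inside
    the real power.\<close>
  also have "\<dots> = 3 * real (order H) powr (1 - tsf_delta / ln (real q))"
    using q1 by (simp add: order powr_power powr_powr flip: powr_realpow) (simp add: mult.commute)
  finally show ?thesis .
qed

end
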